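(* Let $q$ be a prime power and let $t, k$ be positive integers with $t \leq k < q$. Let $\mathcal F$ be a $t$-intersecting family of polynomials in $\mathbb F_q[X]$ such that the degree of each polynomial in $\mathcal F$ is at most $k$. Then $|\mathcal F| \leq q^{k+1-t}$. Furthermore, if $t=1$ and $k \geq 2$, then equality holds if and only if there are elements $x,y \in \mathbb F_q$ such that \[ \mathcal F = \{ f \in \mathbb F_q[X] : \deg f \leq k,\ f(x)=y \}. \]
   Context: $\mathbb F_q$ is the finite field of order $q$. The zero polynomial counts as a polynomial of degree at most $k$. Two polynomials $f,g \in \mathbb F_q[X]$ of degree at most $k$ are called $t$-intersecting if there are at least $t$ values $x \in \mathbb F_q$ with $f(x)=g(x)$. A family (set) $\mathcal F$ of polynomials is $t$-intersecting if any two of its members are $t$-intersecting. *)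

theory Defs
  imports "HOL-Computational_Algebra.Polynomial" "HOL-Library.Cardinality"
begin

text \<open>
  The field of order \<open>q\<close> is a type \<open>'a\<close> of sort \<open>{field, finite}\<close>, with \<open>q = CARD('a)\<close>.
\<close>

definition t_intersecting :: "nat \<Rightarrow> 'a::{field,finite} poly \<Rightarrow> 'a poly \<Rightarrow> bool" where
  "t_intersecting t f g \<longleftrightarrow> t \<le> card {x. poly f x = poly g x}"

text \<open>
  The pair is not required to be distinct; every \<open>f\<close> is \<open>t\<close>-intersecting with itself as soon as
  \<open>t \<le> CARD('a)\<close>.
\<close>

definition t_intersecting_family :: "nat \<Rightarrow> 'a::{field,finite} poly set \<Rightarrow> bool" where
  "t_intersecting_family t F \<longleftrightarrow> (\<forall>f\<in>F. \<forall>g\<in>F. t_intersecting t f g)"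

end

theory Submission imports Defs "HOL-Library.FuncSet" begin

text \<open>
  Let \<open>q = CARD('a)\<close> and let \<open>V\<close> be the space of polynomials of degree at most \<open>k\<close>, of size
  \<open>q^(k+1)\<close>. If two members of a \<open>t\<close>-intersecting family had the same coefficients in degrees
  \<open>t, ..., k\<close>, their difference would have degree below \<open>t\<close> and at least \<open>t\<close> roots. So a member is
  determined by these \<open>k + 1 - t\<close> coefficients, which is the bound (\<open>card_t_intersecting_le\<close>).

  For \<open>t = 1\<close>, \<open>k \<ge> 2\<close>, let \<open>F\<close> be a family with \<open>q^k\<close> members. The characterisation of \<open>F\<close> is a
  small piece of Fourier analysis on \<open>V\<close>, written as counting over hyperplanes.

  If \<open>h \<in> V\<close> has no root, then two members of \<open>F\<close> cannot differ by a nonzero multiple of \<open>h\<close>, so \<open>F\<close>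
  has exactly one point on each line of direction \<open>h\<close> (\<open>bij_betw_rootfree_translates\<close>). If a nonzero
  functional \<open>L\<close> on \<open>V\<close> kills some such \<open>h\<close>, its level sets are unions of these lines, hence \<open>F\<close> is
  equidistributed over them (\<open>card_level_non_evaluation\<close>). Only the multiples of the \<open>q\<close> evaluation
  functionals kill no root-free polynomial: for any other \<open>L\<close>, the polynomials in the kernel of \<open>L\<close>
  with a given root form a subspace of size \<open>q^(k-1)\<close>, and \<open>q\<close> such subspaces, which share \<open>0\<close>, do
  not cover the \<open>q^k\<close> elements of the kernel (\<open>exists_rootfree_in_kernel\<close>).

  Write \<open>N(x, y)\<close> for the number of \<open>g \<in> F\<close> with \<open>g(x) = y\<close>. Counting pairs \<open>(L, g)\<close> with
  \<open>L g = L f\<close> in two ways recovers the indicator function of \<open>F\<close> from the distribution of \<open>F\<close> over all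
  hyperplanes. Since only evaluations contribute a variable amount, this gives
  \<open>(\<Sum>x. N(x, f(x))) + q^(k-1) = q^k + q^k [f \<in> F]\<close> for every \<open>f \<in> V\<close> (\<open>sum_through_graph\<close>).

  The values of a random element of \<open>V\<close> at any three points are independent, because \<open>k \<ge> 2\<close>.
  Averaging the identity over the \<open>f\<close> through two given points yields the number of members of \<open>F\<close>
  through both (\<open>through2_eq\<close>); summing it over the members of \<open>F\<close> through a single point then shows
  that \<open>N(x, y) (q^k - N(x, y))\<close> does not depend on \<open>y\<close> (\<open>through_quadratic\<close>). So for fixed \<open>x\<close> any
  two of the \<open>q \<ge> 3\<close> numbers \<open>N(x, y)\<close>, whose sum is \<open>q^k\<close>, are equal or add up to \<open>q^k\<close>. Either one
  of them is \<open>q^k\<close>, and all of \<open>F\<close> passes through \<open>(x, y)\<close>, or all of them are \<open>q^(k-1)\<close>. The latter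
  cannot happen for every \<open>x\<close>, by the identity for a member of \<open>F\<close> (\<open>exists_full_point\<close>).
\<close>

section \<open>The space of polynomials of bounded degree\<close>

definition polys_upto :: "nat \<Rightarrow> 'a::{field,finite} poly set" where
  "polys_upto k = {f. degree f \<le> k}"

lemma zero_in_polys_upto [simp]: "0 \<in> polys_upto k"
  by (simp add: polys_upto_def)

lemma add_in_polys_upto: "f \<in> polys_upto k \<Longrightarrow> g \<in> polys_upto k \<Longrightarrow> f + g \<in> polys_upto k"
  by (simp add: polys_upto_def degree_add_le)

lemma diff_in_polys_upto: "f \<in> polys_upto k \<Longrightarrow> g \<in> polys_upto k \<Longrightarrow> f - g \<in> polys_upto k"
  by (simp add: polys_upto_def degree_diff_le)

lemma smult_in_polys_upto: "f \<in> polys_upto k \<Longrightarrow> smult c f \<in> polys_upto k"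
  by (simp add: polys_upto_def)

lemma bij_betw_coeffs_polys_upto:
  "bij_betw (\<lambda>f. restrict (coeff f) {..k}) (polys_upto k :: 'a::{field,finite} poly set)
     ({..k} \<rightarrow>\<^sub>E UNIV)"
proof (rule bij_betwI')
  fix f g :: "'a poly" assume fg: "f \<in> polys_upto k" "g \<in> polys_upto k"
  show "(restrict (coeff f) {..k} = restrict (coeff g) {..k}) = (f = g)"
  proof
    assume *: "restrict (coeff f) {..k} = restrict (coeff g) {..k}"
    show "f = g"
    proof (rule poly_eqI)
      fix i show "coeff f i = coeff g i"
        using fun_cong[OF *, of i] fg by (cases "i \<le> k") (auto simp: polys_upto_def coeff_eq_0)
    qed
  qed auto
next
  fix c :: "nat \<Rightarrow> 'a" assume c: "c \<in> {..k} \<rightarrow>\<^sub>E UNIV"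
  let ?f = "\<Sum>i\<le>k. monom (c i) i"
  have co: "coeff ?f j = (if j \<le> k then c j else 0)" for j
    by (simp add: coeff_sum sum.delta)
  have "degree ?f \<le> k" by (rule degree_le) (simp add: co)
  moreover have "c = restrict (coeff ?f) {..k}"
    using c by (auto simp: co restrict_def PiE_def extensional_def)
  ultimately show "\<exists>f\<in>polys_upto k. c = restrict (coeff f) {..k}"
    unfolding polys_upto_def by blast
qed auto

lemma card_polys_upto: "card (polys_upto k :: 'a::{field,finite} poly set) = CARD('a) ^ (k + 1)"
proof -
  have "card (polys_upto k :: 'a poly set) = card ({..k} \<rightarrow>\<^sub>E (UNIV :: 'a set))"
    by (rule bij_betw_same_card[OF bij_betw_coeffs_polys_upto])
  thus ?thesis by (simp add: card_PiE)
qed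

lemma finite_polys_upto [simp]: "finite (polys_upto k :: 'a::{field,finite} poly set)"
  by (rule card_ge_0_finite) (simp add: card_polys_upto)

section \<open>The bound for t-intersecting families\<close>

lemma card_t_intersecting_le:
  fixes F :: "'a::{field,finite} poly set"
  assumes F: "F \<subseteq> polys_upto k" and "t \<le> k" and t: "t_intersecting_family t F" 
  shows "card F \<le> CARD('a) ^ (k + 1 - t)"
proof -
  have "inj_on (\<lambda>f. restrict (coeff f) {t..k}) F"
  proof (rule inj_onI, rule ccontr)
    fix f g assume fg: "f \<in> F" "g \<in> F" "f \<noteq> g"
      and eq: "restrict (coeff f) {t..k} = restrict (coeff g) {t..k}"
    have "degree f \<le> k" "degree g \<le> k" using F fg by (auto simp: polys_upto_def)
    hence "coeff (f - g) i = 0" if "t \<le> i" for i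
      using fun_cong[OF eq, of i] that by (cases "i \<le> k") (auto simp: coeff_eq_0)
    hence "degree (f - g) < t"
      using fg(3) by (metis leI leading_coeff_0_iff right_minus_eq)
    moreover have "card {x. poly (f - g) x = 0} \<le> degree (f - g)"
      using fg(3) by (intro card_poly_roots_bound) auto
    moreover have "t \<le> card {x. poly (f - g) x = 0}"
      using t fg by (auto simp: t_intersecting_family_def t_intersecting_def)
    ultimately show False by linarith
  qed
  hence "card F \<le> card ({t..k} \<rightarrow>\<^sub>E (UNIV :: 'a set))"
    by (rule card_inj_on_le) (auto intro!: finite_PiE)
  thus ?thesis by (simp add: card_PiE)
qed

section \<open>Counting on level sets\<close>

text \<open>
  Translation along \<open>v\<close> changes \<open>\<phi>\<close> at the constant nonzero rate \<open>d\<close>, so every translation orbit in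
  \<open>S\<close> meets the level set \<open>\<phi> = y\<close> exactly once. This serves for linear functionals on subspaces and for
  evaluation on affine subspaces alike.
\<close>

lemma card_level_set:
  fixes S :: "'a::{field,finite} poly set"
  assumes fin: "finite S" and d: "d \<noteq> 0"
    and S: "\<And>f c. f \<in> S \<Longrightarrow> f + smult c v \<in> S"
    and \<phi>: "\<And>f c. f \<in> S \<Longrightarrow> \<phi> (f + smult c v) = \<phi> f + c * d"
  shows "card {f \<in> S. \<phi> f = y} * CARD('a) = card S"
proof -
  have "bij_betw (\<lambda>(f, c). f + smult c v) ({f \<in> S. \<phi> f = y} \<times> UNIV) S"
    by (rule bij_betw_byWitness[where f' = "\<lambda>g. (g - smult ((\<phi> g - y) / d) v, (\<phi> g - y) / d)"])
      (use d S \<phi> S[of _ "- c" for c] \<phi>[of _ "- c" for c] in auto)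
  from bij_betw_same_card[OF this] show ?thesis by (simp add: card_cartesian_product)
qed

text \<open>
  The values at up to \<open>k + 1\<close> points are independent. Each new point \<open>x\<close> is handled by translating
  along \<open>\<Prod>a\<in>A. (X - a)\<close>, which preserves the values on \<open>A\<close> and moves the value at \<open>x\<close>.
\<close>

lemma card_interpolating:
  fixes A :: "'a::{field,finite} set"
  assumes "card A \<le> k + 1"
  shows "card {f \<in> polys_upto k. \<forall>x\<in>A. poly f x = g x} * CARD('a) ^ card A = CARD('a) ^ (k + 1)"
  using finite[of A] assms
proof (induction A rule: finite_induct)
  case empty
  show ?case by (simp add: card_polys_upto)
next
  case (insert x A)
  let ?v = "\<Prod>a\<in>A. [:- a, 1:]" and ?S = "{f \<in> polys_upto k. \<forall>x\<in>A. poly f x = g x}"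
  have deg: "degree ?v \<le> k" using insert by (simp add: degree_prod_eq_sum_degree)
  have "card {f \<in> ?S. poly f x = g x} * CARD('a) = card ?S"
  proof (rule card_level_set[where v = ?v])
    show "poly ?v x \<noteq> 0" using insert by (auto simp: poly_prod)
    show "f + smult c ?v \<in> ?S" if "f \<in> ?S" for f c
      using that insert deg
      by (auto simp: poly_prod polys_upto_def intro!: add_in_polys_upto[unfolded polys_upto_def, simplified])
  qed auto
  moreover have "{f \<in> ?S. poly f x = g x} = {f \<in> polys_upto k. \<forall>x\<in>insert x A. poly f x = g x}"
    by auto
  ultimately have "card {f \<in> polys_upto k. \<forall>x\<in>insert x A. poly f x = g x} * CARD('a) = card ?S"
    by simp
  moreover have "card ?S * CARD('a) ^ card A = CARD('a) ^ (k + 1)" using insert by simp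
  ultimately show ?case
    unfolding card_insert_disjoint[OF insert.hyps] power_Suc mult.assoc[symmetric] by (simp only:)
qed

section \<open>Linear functionals and their root-free kernels\<close>

text \<open>
  The dual of the space of polynomials of degree at most \<open>k\<close> is identified with the space itself, by
  the standard bilinear form on coefficients. Being symmetric, this makes the number of functionals
  that kill a given polynomial an instance of the number of polynomials killed by a functional.
\<close>

definition coeff_pairing :: "nat \<Rightarrow> 'a::{field,finite} poly \<Rightarrow> 'a poly \<Rightarrow> 'a" where
  "coeff_pairing k a f = (\<Sum>i\<le>k. coeff a i * coeff f i)"

lemma coeff_pairing_commute: "coeff_pairing k a f = coeff_pairing k f a"
  by (simp add: coeff_pairing_def mult.commute)

lemma coeff_pairing_0_left [simp]: "coeff_pairing k 0 f = 0"
  by (simp add: coeff_pairing_def)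

lemma coeff_pairing_add_right:
  "coeff_pairing k a (f + g) = coeff_pairing k a f + coeff_pairing k a g"
  by (simp add: coeff_pairing_def sum.distrib algebra_simps)

lemma coeff_pairing_diff_right:
  "coeff_pairing k a (f - g) = coeff_pairing k a f - coeff_pairing k a g"
  by (simp add: coeff_pairing_def sum_subtractf algebra_simps)

lemma coeff_pairing_smult_right: "coeff_pairing k a (smult c f) = c * coeff_pairing k a f"
  by (simp add: coeff_pairing_def sum_distrib_left algebra_simps)

lemma coeff_pairing_smult_left: "coeff_pairing k (smult c a) f = c * coeff_pairing k a f"
  by (simp add: coeff_pairing_def sum_distrib_left algebra_simps)

lemma coeff_pairing_monom: "i \<le> k \<Longrightarrow> coeff_pairing k a (monom c i) = coeff a i * c"
  by (simp add: coeff_pairing_def if_distrib sum.delta cong: if_cong)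

lemma card_coeff_pairing_level:
  assumes "a \<in> polys_upto k" and "a \<noteq> (0 :: 'a::{field,finite} poly)"
  shows "card {f \<in> polys_upto k. coeff_pairing k a f = y} = CARD('a) ^ k"
proof -
  have "card {f \<in> polys_upto k. coeff_pairing k a f = y} * CARD('a) = card (polys_upto k :: 'a poly set)"
  proof (rule card_level_set[where v = "monom 1 (degree a)"])
    show "lead_coeff a \<noteq> 0" using assms by simp
    show "f + smult c (monom 1 (degree a)) \<in> polys_upto k" if "f \<in> polys_upto k" for f c
      using that assms by (intro add_in_polys_upto smult_in_polys_upto)
        (auto simp: polys_upto_def degree_monom_eq)
  next
    have "degree a \<le> k" using assms by (simp add: polys_upto_def)
    thus "coeff_pairing k a (f + smult c (monom 1 (degree a))) = coeff_pairing k a f + c * lead_coeff a" for f c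
      by (simp add: coeff_pairing_add_right coeff_pairing_smult_right coeff_pairing_monom
            del: smult_monom)
  qed simp
  thus ?thesis by (simp add: card_polys_upto)
qed

text \<open>The element that represents evaluation at \<open>x\<close>; see \<open>coeff_pairing_eval_vector\<close>.\<close>

definition eval_vector :: "nat \<Rightarrow> 'a::{field,finite} \<Rightarrow> 'a poly" where
  "eval_vector k x = (\<Sum>i\<le>k. monom (x ^ i) i)"

lemma coeff_eval_vector: "coeff (eval_vector k x) i = (if i \<le> k then x ^ i else 0)"
  by (simp add: eval_vector_def coeff_sum sum.delta)

lemma eval_vector_in_polys_upto: "eval_vector k x \<in> polys_upto k"
  unfolding polys_upto_def by (simp add: degree_le coeff_eval_vector)

lemma coeff_pairing_eval_vector:
  "f \<in> polys_upto k \<Longrightarrow> coeff_pairing k (eval_vector k x) f = poly f x"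
  unfolding coeff_pairing_def poly_altdef
  by (rule sum.mono_neutral_cong_right)
    (auto simp: coeff_eval_vector polys_upto_def coeff_eq_0 mult.commute)

lemma inj_on_scaled_eval_vector:
  assumes "1 \<le> k"
  shows "inj_on (\<lambda>(c, x). smult c (eval_vector k x)) ((UNIV - {0::'a::{field,finite}}) \<times> UNIV)"
proof (clarsimp simp: inj_on_def)
  fix c x c' x' :: 'a
  assume "c \<noteq> 0" and *: "smult c (eval_vector k x) = smult c' (eval_vector k x')"
  have "c = c'" using arg_cong[OF *, of "\<lambda>p. coeff p 0"] by (simp add: coeff_eval_vector)
  moreover have "c * x = c' * x'"
    using arg_cong[OF *, of "\<lambda>p. coeff p 1"] assms by (simp add: coeff_eval_vector)
  ultimately show "c = c' \<and> x = x'" using \<open>c \<noteq> 0\<close> by simp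
qed

text \<open>
  Otherwise evaluation at \<open>x\<close> vanishes on the kernel of \<open>a\<close>, in particular on the binomials
  \<open>a\<^sub>j X\<^sup>i - a\<^sub>i X\<^sup>j\<close>; with \<open>j = 0\<close> this says \<open>a\<^sub>i = a\<^sub>0 x\<^sup>i\<close>.
\<close>

lemma exists_kernel_poly_nonzero_at:
  assumes a: "a \<in> polys_upto k" "a \<noteq> 0" and not_eval: "\<And>c. a \<noteq> smult c (eval_vector k x)"
  shows "\<exists>v\<in>polys_upto k. coeff_pairing k a v = 0 \<and> poly v x \<noteq> 0"
proof (rule ccontr)
  assume *: "\<not> ?thesis"
  have key: "coeff a j * x ^ i = coeff a i * x ^ j" if "i \<le> k" "j \<le> k" for i j
  proof -
    let ?v = "monom (coeff a j) i - monom (coeff a i) j"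
    have "?v \<in> polys_upto k"
      using that by (intro diff_in_polys_upto)
        (auto simp: polys_upto_def intro: order_trans[OF degree_monom_le])
    moreover have "coeff_pairing k a ?v = 0"
      using that by (simp add: coeff_pairing_diff_right coeff_pairing_monom)
    ultimately have "poly ?v x = 0" using * by blast
    thus ?thesis by (simp add: poly_monom)
  qed
  have "a = smult (coeff a 0) (eval_vector k x)"
  proof (rule poly_eqI)
    fix i show "coeff a i = coeff (smult (coeff a 0) (eval_vector k x)) i"
      using key[of i 0] a by (cases "i \<le> k") (auto simp: coeff_eval_vector polys_upto_def coeff_eq_0)
  qed
  thus False using not_eval by blast
qed

text \<open>
  The kernel \<open>H\<close> has \<open>q^k\<close> elements, and those with root \<open>x\<close> form a proper subspace \<open>R x\<close> with \<open>q^(k-1)\<close>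
  elements. As all \<open>R x\<close> contain \<open>0\<close>, their union has at most \<open>q^k - q + 1 < q^k\<close> elements.
\<close>

lemma exists_rootfree_in_kernel:
  fixes a :: "'a::{field,finite} poly"
  assumes k: "1 \<le> k" and a: "a \<in> polys_upto k" "a \<noteq> 0"
    and not_eval: "\<And>c x. a \<noteq> smult c (eval_vector k x)"
  shows "\<exists>h\<in>polys_upto k. coeff_pairing k a h = 0 \<and> (\<forall>x. poly h x \<noteq> 0)"
proof (rule ccontr)
  assume *: "\<not> ?thesis"
  define H where "H = {f \<in> polys_upto k. coeff_pairing k a f = 0}"
  define R where "R x = {f \<in> H. poly f x = 0}" for x
  have H: "card H = CARD('a) ^ k" "finite H"
    using card_coeff_pairing_level[OF a, of 0] by (auto simp: H_def)
  have R: "card (R x) = CARD('a) ^ (k - 1)" for x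
  proof -
    obtain v where v: "v \<in> H" "poly v x \<noteq> 0"
      using exists_kernel_poly_nonzero_at[OF a not_eval] unfolding H_def by blast
    have "card {f \<in> H. poly f x = 0} * CARD('a) = card H"
      by (rule card_level_set[where v = v])
        (use v H in \<open>auto simp: H_def coeff_pairing_add_right coeff_pairing_smult_right
           intro: add_in_polys_upto smult_in_polys_upto\<close>)
    thus ?thesis using H k by (cases k) (auto simp: R_def)
  qed
  have zero: "0 \<in> H" "\<And>x. 0 \<in> R x"
    by (auto simp: H_def R_def coeff_pairing_commute[of k a])
  have fin: "finite (R x)" for x using H by (simp add: R_def)
  have "H \<subseteq> insert 0 (\<Union>x. R x - {0})" using * by (auto simp: H_def R_def)
  hence "card H \<le> card (insert 0 (\<Union>x. R x - {0}))" using fin by (intro card_mono) auto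
  also have "\<dots> \<le> Suc (card (\<Union>x. R x - {0}))" by (rule card_insert_le_m1) auto
  also have "card (\<Union>x. R x - {0}) \<le> (\<Sum>x\<in>UNIV. card (R x - {0}))"
    by (rule card_UN_le) auto
  also have "(\<Sum>x\<in>UNIV. card (R x - {0})) = CARD('a) * (CARD('a) ^ (k - 1) - 1)"
    using zero fin by (simp add: R)
  finally have "CARD('a) ^ k \<le> Suc (CARD('a) ^ k - CARD('a))"
    using k H by (cases k) (auto simp: diff_mult_distrib2)
  moreover have "CARD('a) \<le> CARD('a) ^ k" using k by (simp add: self_le_power)
  moreover have "2 \<le> CARD('a)"
    using card_mono[of UNIV "{0, 1 :: 'a}"] by simp
  ultimately show False by linarith
qed


section \<open>Intersecting families of maximum size\<close>

locale maximum_intersecting =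
  fixes F :: "'a::{field,finite} poly set" and k :: nat
  assumes k: "2 \<le> k" "k < CARD('a)"
    and F_upto: "F \<subseteq> polys_upto k"
    and intersecting: "f \<in> F \<Longrightarrow> g \<in> F \<Longrightarrow> \<exists>x. poly f x = poly g x"
    and card_F: "card F = CARD('a) ^ k"
begin

definition through :: "'a \<Rightarrow> 'a \<Rightarrow> nat" where
  "through x y = card {g \<in> F. poly g x = y}"

lemma finite_F [simp]: "finite F"
  using F_upto finite_polys_upto by (rule finite_subset)

lemma sum_through: "(\<Sum>y\<in>UNIV. through x y) = CARD('a) ^ k"
  using sum.group[of F UNIV "\<lambda>g. poly g x" "\<lambda>_. 1 :: nat"] by (simp add: through_def card_F)

text \<open>
  Each line of direction \<open>h\<close> meets \<open>F\<close> exactly once: members that differ by a nonzero multiple of \<open>h\<close>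
  would agree nowhere, and the size of \<open>F\<close> equals the number of lines.
\<close>

lemma bij_betw_rootfree_translates:
  assumes h: "h \<in> polys_upto k" "\<And>x. poly h x \<noteq> 0"
  shows "bij_betw (\<lambda>(f, c). f + smult c h) (F \<times> UNIV) (polys_upto k)"
proof -
  let ?T = "\<lambda>(f, c). f + smult c h"
  have "f = g \<and> c = d" if "f \<in> F" "g \<in> F" and eq: "f + smult c h = g + smult d h" for f g c d
  proof -
    obtain x where "poly f x = poly g x" using intersecting \<open>f \<in> F\<close> \<open>g \<in> F\<close> by blast
    hence "c * poly h x = d * poly h x" using arg_cong[OF eq, of "\<lambda>p. poly p x"] by simp
    hence "c = d" using h by simp
    thus ?thesis using eq by simp
  qed
  hence inj: "inj_on ?T (F \<times> UNIV)" by (auto simp: inj_on_def)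
  have "?T ` (F \<times> UNIV) = polys_upto k"
    by (rule card_subset_eq)
      (use F_upto h in \<open>auto simp: card_image[OF inj] card_cartesian_product card_F card_polys_upto
         intro!: add_in_polys_upto smult_in_polys_upto\<close>)
  thus ?thesis using inj by (simp add: bij_betw_def)
qed

text \<open>
  A level set of the functional is a union of lines whose direction is a root-free polynomial in its
  kernel.
\<close>

lemma card_level_non_evaluation:
  assumes a: "a \<in> polys_upto k" "a \<noteq> 0" and not_eval: "\<And>c x. a \<noteq> smult c (eval_vector k x)"
  shows "card {g \<in> F. coeff_pairing k a g = y} = CARD('a) ^ (k - 1)"
proof -
  obtain h where h: "h \<in> polys_upto k" "coeff_pairing k a h = 0" "\<And>x. poly h x \<noteq> 0"
    using exists_rootfree_in_kernel[OF _ a not_eval] k by auto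
  let ?T = "\<lambda>(f, c). f + smult c h"
  have bij: "bij_betw ?T (F \<times> UNIV) (polys_upto k)"
    by (rule bij_betw_rootfree_translates) (use h in auto)
  have pair: "coeff_pairing k a (f + smult c h) = coeff_pairing k a f" for f c
    by (simp add: coeff_pairing_add_right coeff_pairing_smult_right h)
  have "bij_betw ?T ({g \<in> F. coeff_pairing k a g = y} \<times> UNIV)
          {f \<in> polys_upto k. coeff_pairing k a f = y}"
  proof (rule bij_betw_subset[OF bij])
    show "?T ` ({g \<in> F. coeff_pairing k a g = y} \<times> UNIV) = {f \<in> polys_upto k. coeff_pairing k a f = y}"
      unfolding bij_betw_imp_surj_on[OF bij, symmetric] by (force simp: pair)
  qed auto
  from bij_betw_same_card[OF this]
  have "card {g \<in> F. coeff_pairing k a g = y} * CARD('a) = CARD('a) ^ k"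
    by (simp add: card_coeff_pairing_level[OF a] card_cartesian_product)
  thus ?thesis using k by (cases k) auto
qed

text \<open>
  Radon inversion. The number of pairs \<open>(a, g)\<close> of a functional and a member of \<open>F\<close> with
  \<open>a(g) = a(f)\<close> is computed in two ways. For fixed \<open>g\<close>, the functionals that kill \<open>g - f\<close> number
  \<open>q^(k+1)\<close> if \<open>g = f\<close>, and \<open>q^k\<close> otherwise. For fixed \<open>a\<close>, there are \<open>q^k\<close> members if \<open>a = 0\<close>,
  \<open>q^(k-1)\<close> if \<open>a\<close> is not a multiple of an evaluation, and the number of members through
  \<open>(x, f(x))\<close> if \<open>a\<close> is one of the \<open>q - 1\<close> nonzero multiples of evaluation at \<open>x\<close>.
\<close>

lemma sum_through_graph:
  assumes f: "f \<in> polys_upto k"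
  shows "(\<Sum>x\<in>UNIV. through x (poly f x)) + CARD('a) ^ (k - 1) = CARD('a) ^ k + (if f \<in> F then CARD('a) ^ k else 0)"
proof -
  define M where "M a = card {g \<in> F. coeff_pairing k a g = coeff_pairing k a f}" for a
  define E where "E = (\<lambda>(c, x). smult c (eval_vector k x)) ` ((UNIV - {0 :: 'a}) \<times> UNIV)"
  define \<Sigma> where "\<Sigma> = (\<Sum>x\<in>UNIV. through x (poly f x))"
  have inj: "inj_on (\<lambda>(c, x). smult c (eval_vector k x)) ((UNIV - {0 :: 'a}) \<times> UNIV)"
    using k by (intro inj_on_scaled_eval_vector) auto
  have E_upto: "E \<subseteq> polys_upto k"
    by (auto simp: E_def intro: smult_in_polys_upto eval_vector_in_polys_upto)
  have fin: "finite E" by (simp add: E_def)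
  have nonzero: "eval_vector k x \<noteq> 0" for x :: 'a
    using coeff_eval_vector[of k x 0] by auto
  hence "0 \<notin> E" by (auto simp: E_def)
  have card_E: "card E = (CARD('a) - 1) * CARD('a)"
    unfolding E_def by (simp add: card_image[OF inj] card_cartesian_product card_Diff_singleton)

  \<comment> \<open>the sum over all functionals, first by summing over members of \<open>F\<close>\<close>
  have "(\<Sum>a\<in>polys_upto k. M a) = (\<Sum>a\<in>polys_upto k. \<Sum>g\<in>F. of_bool (coeff_pairing k a g = coeff_pairing k a f))"
    by (simp add: M_def Int_def)
  also have "\<dots> = (\<Sum>g\<in>F. \<Sum>a\<in>polys_upto k. of_bool (coeff_pairing k a g = coeff_pairing k a f))"
    by (rule sum.swap)
  also have "\<dots> = (\<Sum>g\<in>F. card {a \<in> polys_upto k. coeff_pairing k a (g - f) = 0})"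
    by (simp add: Int_def coeff_pairing_diff_right)
  also have "\<dots> = (\<Sum>g\<in>F. if g = f then CARD('a) ^ (k + 1) else CARD('a) ^ k)"
  proof (rule sum.cong)
    fix g assume "g \<in> F"
    hence "g - f \<in> polys_upto k" using F_upto f by (auto intro: diff_in_polys_upto)
    thus "card {a \<in> polys_upto k. coeff_pairing k a (g - f) = 0} = (if g = f then CARD('a) ^ (k + 1) else CARD('a) ^ k)"
      using card_coeff_pairing_level[of "g - f" k 0]
      by (auto simp: coeff_pairing_commute[of k _ "g - f"] card_polys_upto)
  qed simp
  finally have "int (\<Sum>a\<in>polys_upto k. M a) = (\<Sum>g\<in>F. int CARD('a) ^ k + (if g = f then int CARD('a) ^ (k + 1) - int CARD('a) ^ k else 0))"
    by (auto intro!: sum.cong)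
  also have "\<dots> = int CARD('a) ^ k * int CARD('a) ^ k + (if f \<in> F then int CARD('a) ^ (k + 1) - int CARD('a) ^ k else 0)"
    by (simp only: sum.distrib) (simp add: card_F)
  finally have total: "int (\<Sum>a\<in>polys_upto k. M a) = \<dots>" .

  \<comment> \<open>the same sum, split into multiples of evaluations, the zero functional and all others\<close>
  have "(\<Sum>a\<in>E. M a) = (\<Sum>(c, x)\<in>(UNIV - {0}) \<times> UNIV. M (smult c (eval_vector k x)))"
    unfolding E_def by (subst sum.reindex[OF inj]) (simp add: case_prod_unfold o_def)
  also have "\<dots> = (\<Sum>(c, x)\<in>(UNIV - {0 :: 'a}) \<times> UNIV. through x (poly f x))"
  proof (rule sum.cong[OF refl])
    fix p :: "'a \<times> 'a" assume "p \<in> (UNIV - {0}) \<times> UNIV"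
    then obtain c x where p: "p = (c, x)" and "c \<noteq> 0" by auto
    have "{g \<in> F. coeff_pairing k (smult c (eval_vector k x)) g = coeff_pairing k (smult c (eval_vector k x)) f}
        = {g \<in> F. poly g x = poly f x}"
      using \<open>c \<noteq> 0\<close> f F_upto
      by (auto simp: coeff_pairing_smult_left coeff_pairing_eval_vector subset_iff)
    thus "(case p of (c, x) \<Rightarrow> M (smult c (eval_vector k x))) = (case p of (c, x) \<Rightarrow> through x (poly f x))"
      by (simp add: p M_def through_def)
  qed
  also have "\<dots> = (CARD('a) - 1) * \<Sigma>"
    by (simp add: sum.cartesian_product[symmetric] \<Sigma>_def card_Diff_singleton)
  finally have sum_E: "(\<Sum>a\<in>E. M a) = (CARD('a) - 1) * \<Sigma>" .

  have "M a = CARD('a) ^ (k - 1)" if "a \<in> polys_upto k - insert 0 E" for a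
  proof -
    have "a \<noteq> smult c (eval_vector k x)" for c x
    proof (cases "c = 0")
      case False
      hence "smult c (eval_vector k x) \<in> E" by (force simp: E_def)
      thus ?thesis using that by blast
    qed (use that in auto)
    thus ?thesis unfolding M_def using that by (intro card_level_non_evaluation) auto
  qed
  hence sum_rest: "(\<Sum>a\<in>polys_upto k - insert 0 E. M a) = card (polys_upto k - insert 0 E) * CARD('a) ^ (k - 1)"
    by simp
  have "card (insert 0 E) = 1 + (CARD('a) - 1) * CARD('a)" using fin \<open>0 \<notin> E\<close> by (simp add: card_E)
  hence "int (card (insert 0 E)) = 1 + (int CARD('a) - 1) * int CARD('a)" using k by (simp add: of_nat_diff)
  moreover have "card (polys_upto k - insert 0 E) + card (insert 0 E) = CARD('a) ^ (k + 1)"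
    using E_upto card_mono[of "polys_upto k" "insert 0 E"] fin
    by (subst card_Diff_subset) (auto simp: card_polys_upto)
  ultimately have card_rest: "int (card (polys_upto k - insert 0 E))
      = int CARD('a) ^ (k + 1) - (1 + (int CARD('a) - 1) * int CARD('a))"
    by (metis add_diff_cancel_right' of_nat_add of_nat_power)
  have "(\<Sum>a\<in>polys_upto k. M a) = (\<Sum>a\<in>polys_upto k - insert 0 E. M a) + (\<Sum>a\<in>insert 0 E. M a)"
    using E_upto fin by (intro sum.subset_diff) auto
  also have "(\<Sum>a\<in>insert 0 E. M a) = CARD('a) ^ k + (CARD('a) - 1) * \<Sigma>"
    by (subst sum.insert[OF fin \<open>0 \<notin> E\<close>]) (simp add: sum_E, simp add: M_def card_F)
  finally have "int (\<Sum>a\<in>polys_upto k. M a) = int (card (polys_upto k - insert 0 E) * CARD('a) ^ (k - 1) + (CARD('a) ^ k + (CARD('a) - 1) * \<Sigma>))"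
    by (simp only: sum_rest)
  also have "\<dots> = (int CARD('a) ^ (k + 1) - (1 + (int CARD('a) - 1) * int CARD('a))) * int CARD('a) ^ (k - 1) + (int CARD('a) ^ k + (int CARD('a) - 1) * int \<Sigma>)"
    unfolding of_nat_add of_nat_mult card_rest using k by (simp add: of_nat_diff)
  finally have eq: "(int CARD('a) ^ (k + 1) - (1 + (int CARD('a) - 1) * int CARD('a))) * int CARD('a) ^ (k - 1) + (int CARD('a) ^ k + (int CARD('a) - 1) * int \<Sigma>)
      = int CARD('a) ^ k * int CARD('a) ^ k + (if f \<in> F then int CARD('a) ^ (k + 1) - int CARD('a) ^ k else 0)"
    using total by (rule trans[OF sym])
  obtain j where j: "k = Suc j" using k by (cases k) auto
  have "(int CARD('a) - 1) * (int \<Sigma> + int CARD('a) ^ j) = (int CARD('a) - 1) * (int CARD('a) ^ k + (if f \<in> F then int CARD('a) ^ k else 0))"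
    using eq unfolding j by (cases "f \<in> F") (simp_all add: algebra_simps)
  hence "int \<Sigma> + int CARD('a) ^ j = int CARD('a) ^ k + (if f \<in> F then int CARD('a) ^ k else 0)"
    using k by simp
  hence "int (\<Sigma> + CARD('a) ^ j) = int (CARD('a) ^ k + (if f \<in> F then CARD('a) ^ k else 0))"
    by (cases "f \<in> F") simp_all
  hence "\<Sigma> + CARD('a) ^ j = CARD('a) ^ k + (if f \<in> F then CARD('a) ^ k else 0)"
    by (simp only: of_nat_eq_iff)
  thus ?thesis unfolding \<Sigma>_def j by simp
qed

definition through2 :: "'a \<Rightarrow> 'a \<Rightarrow> 'a \<Rightarrow> 'a \<Rightarrow> nat" where
  "through2 x y x' y' = card {g \<in> F. poly g x = y \<and> poly g x' = y'}"

text \<open>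
  The identity of \<open>sum_through_graph\<close> is summed over the set \<open>T\<close> of all polynomials through two points.
  Abscissae other than the two given ones contribute a constant, since the values of
  the elements of \<open>T\<close> there are uniformly distributed; this needs \<open>k \<ge> 2\<close>.
\<close>

lemma through2_eq:
  assumes "x\<^sub>0 \<noteq> x\<^sub>1"
  shows "CARD('a) * through2 x\<^sub>0 y\<^sub>0 x\<^sub>1 y\<^sub>1 + CARD('a) ^ (k - 1) = through x\<^sub>0 y\<^sub>0 + through x\<^sub>1 y\<^sub>1"
proof -
  obtain m where m: "k = Suc (Suc m)" using k(1) by (intro that[of "k - 2"]) simp
  define T where "T = {f \<in> polys_upto k. poly f x\<^sub>0 = y\<^sub>0 \<and> poly f x\<^sub>1 = y\<^sub>1}"
  have finT: "finite T" by (simp add: T_def)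
  have "card T * CARD('a) ^ 2 = CARD('a) ^ 3 * CARD('a) ^ m"
    using card_interpolating[of "{x\<^sub>0, x\<^sub>1}" k "\<lambda>x. if x = x\<^sub>0 then y\<^sub>0 else y\<^sub>1"] assms
    by (simp add: T_def m eval_nat_numeral conj_commute)
  hence card_T: "card T = CARD('a) * CARD('a) ^ m" by (simp add: eval_nat_numeral)
  have other: "(\<Sum>f\<in>T. through x (poly f x)) = CARD('a) ^ m * CARD('a) ^ k" if x: "x \<noteq> x\<^sub>0" "x \<noteq> x\<^sub>1" for x
  proof -
    have "card {f \<in> T. poly f x = y} = CARD('a) ^ m" for y
    proof -
      have "card {f \<in> polys_upto k. \<forall>z\<in>{x\<^sub>0, x\<^sub>1, x}. poly f z = (if z = x\<^sub>0 then y\<^sub>0 else if z = x\<^sub>1 then y\<^sub>1 else y)} * CARD('a) ^ 3 = CARD('a) ^ 3 * CARD('a) ^ m"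
        using card_interpolating[of "{x\<^sub>0, x\<^sub>1, x}" k "\<lambda>z. if z = x\<^sub>0 then y\<^sub>0 else if z = x\<^sub>1 then y\<^sub>1 else y"] assms x
        by (simp add: m eval_nat_numeral)
      moreover have "{f \<in> polys_upto k. \<forall>z\<in>{x\<^sub>0, x\<^sub>1, x}. poly f z = (if z = x\<^sub>0 then y\<^sub>0 else if z = x\<^sub>1 then y\<^sub>1 else y)} = {f \<in> T. poly f x = y}"
        using assms x by (auto simp: T_def)
      ultimately show ?thesis by simp
    qed
    moreover have "(\<Sum>f\<in>T. through x (poly f x)) = (\<Sum>y\<in>UNIV. \<Sum>f\<in>{f \<in> T. poly f x = y}. through x (poly f x))"
      by (rule sum.group[symmetric]) (use finT in auto)
    ultimately show ?thesis by (simp add: sum_distrib_left[symmetric] sum_through)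
  qed
  have "(\<Sum>f\<in>T. \<Sum>x\<in>UNIV. through x (poly f x)) + card T * CARD('a) ^ (k - 1)
      = (\<Sum>f\<in>T. (\<Sum>x\<in>UNIV. through x (poly f x)) + CARD('a) ^ (k - 1))"
    by (simp add: sum.distrib)
  also have "\<dots> = (\<Sum>f\<in>T. CARD('a) ^ k + (if f \<in> F then CARD('a) ^ k else 0))"
    by (rule sum.cong[OF refl], rule sum_through_graph) (simp add: T_def)
  also have "\<dots> = card T * CARD('a) ^ k + (\<Sum>f\<in>{f \<in> T. f \<in> F}. CARD('a) ^ k)"
    by (simp only: sum.distrib sum.inter_filter[OF finT]) simp
  also have "{f \<in> T. f \<in> F} = {g \<in> F. poly g x\<^sub>0 = y\<^sub>0 \<and> poly g x\<^sub>1 = y\<^sub>1}"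
    using F_upto by (auto simp: T_def)
  also have "(\<Sum>f\<in>\<dots>. CARD('a) ^ k) = through2 x\<^sub>0 y\<^sub>0 x\<^sub>1 y\<^sub>1 * CARD('a) ^ k"
    by (simp add: through2_def)
  finally have incidences: "(\<Sum>f\<in>T. \<Sum>x\<in>UNIV. through x (poly f x)) + card T * CARD('a) ^ (k - 1)
      = card T * CARD('a) ^ k + through2 x\<^sub>0 y\<^sub>0 x\<^sub>1 y\<^sub>1 * CARD('a) ^ k" .
  have "(\<Sum>f\<in>T. \<Sum>x\<in>UNIV. through x (poly f x)) = (\<Sum>x\<in>UNIV. \<Sum>f\<in>T. through x (poly f x))"
    by (rule sum.swap)
  also have "\<dots> = (\<Sum>x\<in>UNIV - {x\<^sub>0, x\<^sub>1}. \<Sum>f\<in>T. through x (poly f x)) + (\<Sum>x\<in>{x\<^sub>0, x\<^sub>1}. \<Sum>f\<in>T. through x (poly f x))"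
    by (rule sum.subset_diff) auto
  also have "(\<Sum>x\<in>{x\<^sub>0, x\<^sub>1}. \<Sum>f\<in>T. through x (poly f x)) = card T * (through x\<^sub>0 y\<^sub>0 + through x\<^sub>1 y\<^sub>1)"
    using assms by (simp add: T_def algebra_simps)
  also have "(\<Sum>x\<in>UNIV - {x\<^sub>0, x\<^sub>1}. \<Sum>f\<in>T. through x (poly f x)) = (CARD('a) - 2) * (CARD('a) ^ m * CARD('a) ^ k)"
    using assms by (simp add: other card_Diff_subset)
  finally have "(CARD('a) - 2) * (CARD('a) ^ m * CARD('a) ^ k) + card T * (through x\<^sub>0 y\<^sub>0 + through x\<^sub>1 y\<^sub>1)
      + card T * CARD('a) ^ (k - 1) = card T * CARD('a) ^ k + through2 x\<^sub>0 y\<^sub>0 x\<^sub>1 y\<^sub>1 * CARD('a) ^ k"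
    using incidences by (simp only:)
  from arg_cong[OF this, of int]
  have "(int CARD('a) - 2) * (int CARD('a) ^ m * int CARD('a) ^ k)
      + int CARD('a) * int CARD('a) ^ m * (int (through x\<^sub>0 y\<^sub>0) + int (through x\<^sub>1 y\<^sub>1))
      + int CARD('a) * int CARD('a) ^ m * int CARD('a) ^ (k - 1)
      = int CARD('a) * int CARD('a) ^ m * int CARD('a) ^ k + int (through2 x\<^sub>0 y\<^sub>0 x\<^sub>1 y\<^sub>1) * int CARD('a) ^ k"
    unfolding card_T of_nat_add of_nat_mult of_nat_power using k by (simp only: of_nat_diff) simp
  hence "int CARD('a) * int CARD('a) ^ m * (int CARD('a) * int (through2 x\<^sub>0 y\<^sub>0 x\<^sub>1 y\<^sub>1) + int CARD('a) ^ (k - 1))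
      = int CARD('a) * int CARD('a) ^ m * (int (through x\<^sub>0 y\<^sub>0) + int (through x\<^sub>1 y\<^sub>1))"
    unfolding m by (simp add: algebra_simps)
  hence "int (CARD('a) * through2 x\<^sub>0 y\<^sub>0 x\<^sub>1 y\<^sub>1 + CARD('a) ^ (k - 1)) = int (through x\<^sub>0 y\<^sub>0 + through x\<^sub>1 y\<^sub>1)"
    by simp
  thus ?thesis by (simp only: of_nat_eq_iff)
qed

text \<open>
  The point of this formula is that its right-hand side is independent of \<open>y\<^sub>0\<close>. It is obtained by
  summing the identity of \<open>sum_through_graph\<close> over the members of \<open>F\<close> through \<open>(x\<^sub>0, y\<^sub>0)\<close>, and
  eliminating the numbers of members through two points by \<open>through2_eq\<close>.
\<close>

lemma through_quadratic:
  "int CARD('a) * (int (through x\<^sub>0 y\<^sub>0) * (int CARD('a) ^ k - int (through x\<^sub>0 y\<^sub>0)))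
     = (\<Sum>x\<in>UNIV - {x\<^sub>0}. \<Sum>y\<in>UNIV. (int (through x y))\<^sup>2) - (int CARD('a) - 1) * (int CARD('a) ^ k * int CARD('a) ^ (k - 1))"
proof -
  define F\<^sub>0 where "F\<^sub>0 = {g \<in> F. poly g x\<^sub>0 = y\<^sub>0}"
  define R where "R = (\<Sum>x\<in>UNIV - {x\<^sub>0}. \<Sum>g\<in>F\<^sub>0. through x (poly g x))"
  define A where "A = (\<Sum>x\<in>UNIV - {x\<^sub>0}. \<Sum>y\<in>UNIV. (int (through x y))\<^sup>2)"
  have [simp]: "card F\<^sub>0 = through x\<^sub>0 y\<^sub>0" "finite F\<^sub>0" by (simp_all add: F\<^sub>0_def through_def)
  have other: "int CARD('a) * int (\<Sum>g\<in>F\<^sub>0. through x (poly g x))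
      = int (through x\<^sub>0 y\<^sub>0) * int CARD('a) ^ k + (\<Sum>y\<in>UNIV. (int (through x y))\<^sup>2) - int CARD('a) ^ k * int CARD('a) ^ (k - 1)"
    if x: "x \<noteq> x\<^sub>0" for x
  proof -
    have "(\<Sum>g\<in>F\<^sub>0. through x (poly g x)) = (\<Sum>y\<in>UNIV. \<Sum>g\<in>{g \<in> F\<^sub>0. poly g x = y}. through x (poly g x))"
      by (rule sum.group[symmetric]) auto
    also have "\<dots> = (\<Sum>y\<in>UNIV. through2 x\<^sub>0 y\<^sub>0 x y * through x y)"
      by (simp add: F\<^sub>0_def through2_def conj_assoc)
    finally have "int CARD('a) * int (\<Sum>g\<in>F\<^sub>0. through x (poly g x)) = (\<Sum>y\<in>UNIV. (int CARD('a) * int (through2 x\<^sub>0 y\<^sub>0 x y)) * int (through x y))"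
      by (simp add: sum_distrib_left mult.assoc)
    also have "\<dots> = (\<Sum>y\<in>UNIV. (int (through x\<^sub>0 y\<^sub>0) - int CARD('a) ^ (k - 1)) * int (through x y) + (int (through x y))\<^sup>2)"
    proof (rule sum.cong)
      fix y
      have "int CARD('a) * int (through2 x\<^sub>0 y\<^sub>0 x y) = int (through x\<^sub>0 y\<^sub>0) - int CARD('a) ^ (k - 1) + int (through x y)"
        using arg_cong[OF through2_eq[of x\<^sub>0 x y\<^sub>0 y], of int] x by simp
      thus "(int CARD('a) * int (through2 x\<^sub>0 y\<^sub>0 x y)) * int (through x y) = (int (through x\<^sub>0 y\<^sub>0) - int CARD('a) ^ (k - 1)) * int (through x y) + (int (through x y))\<^sup>2"
        by (simp only:) (simp add: algebra_simps power2_eq_square)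
    qed simp
    also have "\<dots> = (int (through x\<^sub>0 y\<^sub>0) - int CARD('a) ^ (k - 1)) * int (\<Sum>y\<in>UNIV. through x y) + (\<Sum>y\<in>UNIV. (int (through x y))\<^sup>2)"
      by (simp add: sum.distrib sum_distrib_left)
    finally show ?thesis by (simp add: sum_through algebra_simps)
  qed
  have "(\<Sum>g\<in>F\<^sub>0. (\<Sum>x\<in>UNIV. through x (poly g x)) + CARD('a) ^ (k - 1)) = (\<Sum>g\<in>F\<^sub>0. 2 * CARD('a) ^ k)"
  proof (rule sum.cong)
    fix g assume "g \<in> F\<^sub>0"
    hence "g \<in> F" by (simp add: F\<^sub>0_def)
    thus "(\<Sum>x\<in>UNIV. through x (poly g x)) + CARD('a) ^ (k - 1) = 2 * CARD('a) ^ k"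
      using sum_through_graph[of g] F_upto by auto
  qed simp
  hence "(\<Sum>x\<in>UNIV. \<Sum>g\<in>F\<^sub>0. through x (poly g x)) + through x\<^sub>0 y\<^sub>0 * CARD('a) ^ (k - 1) = through x\<^sub>0 y\<^sub>0 * (2 * CARD('a) ^ k)"
    by (subst sum.swap) (simp add: sum.distrib)
  moreover have "(\<Sum>x\<in>UNIV. \<Sum>g\<in>F\<^sub>0. through x (poly g x)) = (\<Sum>g\<in>F\<^sub>0. through x\<^sub>0 (poly g x\<^sub>0)) + R"
    unfolding R_def by (rule sum.remove) auto
  moreover have "(\<Sum>g\<in>F\<^sub>0. through x\<^sub>0 (poly g x\<^sub>0)) = through x\<^sub>0 y\<^sub>0 * through x\<^sub>0 y\<^sub>0"
    by (simp add: F\<^sub>0_def through_def)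
  ultimately have "through x\<^sub>0 y\<^sub>0 * through x\<^sub>0 y\<^sub>0 + R + through x\<^sub>0 y\<^sub>0 * CARD('a) ^ (k - 1) = through x\<^sub>0 y\<^sub>0 * (2 * CARD('a) ^ k)"
    by simp
  from arg_cong[OF this, of int] have R: "int R = int (through x\<^sub>0 y\<^sub>0) * (2 * int CARD('a) ^ k)
      - int (through x\<^sub>0 y\<^sub>0) * int (through x\<^sub>0 y\<^sub>0) - int (through x\<^sub>0 y\<^sub>0) * int CARD('a) ^ (k - 1)"
    by simp
  have "int CARD('a) * int R = (\<Sum>x\<in>UNIV - {x\<^sub>0}. int CARD('a) * int (\<Sum>g\<in>F\<^sub>0. through x (poly g x)))"
    by (simp add: R_def sum_distrib_left)
  also have "\<dots> = (\<Sum>x\<in>UNIV - {x\<^sub>0}. (int (through x\<^sub>0 y\<^sub>0) * int CARD('a) ^ k - int CARD('a) ^ k * int CARD('a) ^ (k - 1))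
      + (\<Sum>y\<in>UNIV. (int (through x y))\<^sup>2))"
    by (rule sum.cong[OF refl], subst other) auto
  also have "\<dots> = (int CARD('a) - 1) * (int (through x\<^sub>0 y\<^sub>0) * int CARD('a) ^ k - int CARD('a) ^ k * int CARD('a) ^ (k - 1)) + A"
    using k by (simp add: A_def sum.distrib card_Diff_singleton of_nat_diff)
  finally have A: "A = int CARD('a) * int R
      - (int CARD('a) - 1) * (int (through x\<^sub>0 y\<^sub>0) * int CARD('a) ^ k - int CARD('a) ^ k * int CARD('a) ^ (k - 1))"
    by linarith
  obtain j where "k = Suc j" using k by (cases k) auto
  thus ?thesis unfolding A_def[symmetric] A R by (simp add: algebra_simps)
qed

text \<open>
  If the counts over some \<open>x\<close> are not all equal, two of them add up to \<open>q^k\<close>, a third one is \<open>0\<close>, and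
  the quadratic relation leaves only the values \<open>0\<close> and \<open>q^k\<close>. If the counts over every \<open>x\<close> are
  equal, a member of \<open>F\<close> violates \<open>sum_through_graph\<close>.
\<close>

lemma exists_full_point: "\<exists>x y. through x y = CARD('a) ^ k"
proof (rule ccontr)
  assume *: "\<not> ?thesis"
  have const: "through x y = through x y'" for x y y'
  proof (rule ccontr)
    assume ne: "through x y \<noteq> through x y'"
    \<comment> \<open>both counts are roots of one polynomial \<open>X\<^sup>2 - q^k X + c\<close>\<close>
    have root: "through x u = through x v \<or> through x u + through x v = CARD('a) ^ k" for u v
    proof -
      have "int CARD('a) * (int (through x u) * (int CARD('a) ^ k - int (through x u))) = int CARD('a) * (int (through x v) * (int CARD('a) ^ k - int (through x v)))"
        unfolding through_quadratic ..
      hence "int (through x u) * (int CARD('a) ^ k - int (through x u)) = int (through x v) * (int CARD('a) ^ k - int (through x v))"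
        using k by simp
      hence "(int (through x u) - int (through x v)) * (int CARD('a) ^ k - (int (through x u) + int (through x v))) = 0"
        by (simp add: algebra_simps)
      hence "int (through x u) = int (through x v) \<or> int (through x u + through x v) = int (CARD('a) ^ k)" by auto
      thus ?thesis by linarith
    qed
    \<comment> \<open>\<open>y\<close> and \<open>y'\<close> already account for all of \<open>F\<close>, so nothing passes through a third point \<open>(x, z)\<close>\<close>
    have "y \<noteq> y'" using ne by auto
    have "card {y, y'} < CARD('a)" using k by (cases "y = y'") auto
    then obtain z where z: "z \<noteq> y" "z \<noteq> y'"
      by (metis (full_types) UNIV_I card_mono finite insertCI insertE leD subsetI)
    have "sum (through x) {y, y', z} \<le> sum (through x) UNIV" by (rule sum_mono2) auto
    moreover have "sum (through x) {y, y', z} = through x y + through x y' + through x z"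
      using z \<open>y \<noteq> y'\<close> by auto
    ultimately have "through x z = 0" using root[of y y'] ne by (simp add: sum_through)
    thus False using root[of y z] root[of y' z] * ne by auto
  qed
  obtain j where j: "k = Suc j" using k by (cases k) auto
  have uniform: "through x y = CARD('a) ^ j" for x y
  proof -
    have "(\<Sum>y'\<in>UNIV. through x y') = CARD('a) * through x y"
      by (subst sum.cong[OF refl const[of x _ y]]) simp
    thus ?thesis by (simp add: sum_through j)
  qed
  have "F \<noteq> {}" using card_F by auto
  then obtain f where "f \<in> F" by blast
  with sum_through_graph[of f] F_upto have "CARD('a) * CARD('a) ^ j + CARD('a) ^ j = 2 * (CARD('a) * CARD('a) ^ j)" by (auto simp: uniform j)
  hence "CARD('a) = 1" by simp
  thus False using k by simp
qed

end

section \<open>The bound and its equality case\<close>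

lemma card_polys_through_point:
  fixes x y :: "'a::{field,finite}"
  shows "card {f. degree f \<le> k \<and> poly f x = y} = CARD('a) ^ k"
  using card_interpolating[of "{x}" k "\<lambda>_. y"] by (simp add: polys_upto_def)

theorem theorem1p2:
  fixes F :: "'a::{field,finite} poly set" and q t k :: nat
  assumes "q = CARD('a)"
    and "1 \<le> t" and "t \<le> k" and "k < q"
    and "\<forall>f\<in>F. degree f \<le> k"
    and "t_intersecting_family t F"
  shows "finite F \<and> card F \<le> q ^ (k + 1 - t) \<and>
    (t = 1 \<and> 2 \<le> k \<longrightarrow>
      (card F = q ^ (k + 1 - t) \<longleftrightarrow>
        (\<exists>x y. F = {f. degree f \<le> k \<and> poly f x = y})))"
proof (intro conjI impI)
  have sub: "F \<subseteq> polys_upto k" using assms by (auto simp: polys_upto_def)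
  show "finite F" using sub finite_polys_upto by (rule finite_subset)
  show "card F \<le> q ^ (k + 1 - t)"
    using card_t_intersecting_le[OF sub] assms by simp
  assume t: "t = 1 \<and> 2 \<le> k"
  show "card F = q ^ (k + 1 - t) \<longleftrightarrow> (\<exists>x y. F = {f. degree f \<le> k \<and> poly f x = y})"
  proof
    assume card: "card F = q ^ (k + 1 - t)"
    interpret maximum_intersecting F k
    proof
      fix f g assume "f \<in> F" "g \<in> F"
      hence "{x. poly f x = poly g x} \<noteq> {}"
        using assms(6) t by (fastforce simp: t_intersecting_family_def t_intersecting_def)
      thus "\<exists>x. poly f x = poly g x" by blast
    qed (use assms t sub card in auto)
    obtain x y where xy: "through x y = CARD('a) ^ k" using exists_full_point by blast
    have all: "{g \<in> F. poly g x = y} = F"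
      using xy by (intro card_subset_eq) (auto simp: through_def card_F)
    have "F = {f. degree f \<le> k \<and> poly f x = y}"
    proof (rule card_subset_eq)
      show "finite {f. degree f \<le> k \<and> poly f x = y}"
        by (rule card_ge_0_finite) (simp add: card_polys_through_point)
      show "F \<subseteq> {f. degree f \<le> k \<and> poly f x = y}"
        using all assms by blast
    qed (simp add: card_polys_through_point card_F)
    thus "\<exists>x y. F = {f. degree f \<le> k \<and> poly f x = y}" by blast
  next
    assume "\<exists>x y. F = {f. degree f \<le> k \<and> poly f x = y}"
    thus "card F = q ^ (k + 1 - t)" using t assms by (auto simp: card_polys_through_point)
  qed
qed

end
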